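(* Let $\beta>-1$ and let $\alpha_k=\frac{k-1}{k+\beta}$ for $k\ge 1$. Let $(r_k)_{k\ge 0}$ be the residual polynomials of the Nesterov acceleration with this sequence $\alpha_k$, i.e. the polynomials given by $r_0(\lambda)=1$, $r_1(\lambda)=1-\lambda$ and $$r_{k+1}(\lambda)=(1-\lambda)\left[r_k(\lambda)+\alpha_k\left(r_k(\lambda)-r_{k-1}(\lambda)\right)\right],\qquad k\ge 1.$$ Then, for all $k\ge 1$ and $0\le\lambda\le 1$, $$r_k(\lambda)=(1-\lambda)^{\frac{k+1}{2}}\,\frac{C_{k-1}^{(\frac{\beta+1}{2})}(\sqrt{1-\lambda})}{C_{k-1}^{(\frac{\beta+1}{2})}(1)},$$ where $C_n^{(\alpha)}$ denotes the Gegenbauer polynomials.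
   Context: Let $X,Y$ be Hilbert spaces, $A:X\to Y$ a bounded linear operator with $\|A^*A\|\le 1$, and $y^\delta\in Y$. The Nesterov acceleration is the iteration $$x_0^\delta=0,\quad x_1^\delta=A^*y^\delta,\quad z_k^\delta=x_k^\delta+\alpha_k(x_k^\delta-x_{k-1}^\delta),\quad x_{k+1}^\delta=z_k^\delta+A^*(y^\delta-Az_k^\delta),\qquad k\ge 1.$$ Its residuals are $y^\delta-Ax_k^\delta=r_k(AA^* )y^\delta$, where the residual polynomials $r_k$ satisfy the recurrence written in the claim. The Gegenbauer (ultraspherical) polynomials $C_n^{(\alpha)}$, $\alpha>0$, are given by $C_0^{(\alpha)}(x)=1$, $C_1^{(\alpha)}(x)=2\alpha x$ and $k\,C_k^{(\alpha)}(x)=2(k+\alpha-1)\,x\,C_{k-1}^{(\alpha)}(x)-(k+2\alpha-2)\,C_{k-2}^{(\alpha)}(x)$ for $k\ge 2$. *)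

theory Defs
  imports Complex_Main "HOL-Computational_Algebra.Polynomial"
begin

text \<open>
  Residual polynomials of the Nesterov acceleration with an arbitrary sequence of
  extrapolation parameters \<open>a\<close>: the iterates satisfy
  \<open>y - A x\<^sub>k = r\<^sub>k (A A\<^sup>*) y\<close>, where \<open>r\<^sub>k\<close> is \<open>nesterov_residual a k\<close>.
  The third equation is the recurrence for index \<open>k = Suc n\<close>, i.e. for \<open>k \<ge> 1\<close>, so the value
  \<open>a 0\<close> is never used.
\<close>

fun nesterov_residual :: "(nat \<Rightarrow> real) \<Rightarrow> nat \<Rightarrow> real poly" where
  "nesterov_residual a 0 = 1"
| "nesterov_residual a (Suc 0) = [:1, -1:]"
| "nesterov_residual a (Suc (Suc n)) =
     [:1, -1:] * (nesterov_residual a (Suc n) +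
       smult (a (Suc n)) (nesterov_residual a (Suc n) - nesterov_residual a n))"

text \<open>
  Gegenbauer polynomials \<open>C\<^sub>k\<close> with parameter \<open>\<alpha>\<close>. The third equation is
  \<open>k C\<^sub>k(x) = 2 (k + \<alpha> - 1) x C\<^sub>k\<^sub>-\<^sub>1(x) - (k + 2 \<alpha> - 2) C\<^sub>k\<^sub>-\<^sub>2(x)\<close>, divided by \<open>k = n + 2\<close>.
\<close>

fun gegenbauer :: "real \<Rightarrow> nat \<Rightarrow> real poly" where
  "gegenbauer \<alpha> 0 = 1"
| "gegenbauer \<alpha> (Suc 0) = [:0, 2 * \<alpha>:]"
| "gegenbauer \<alpha> (Suc (Suc n)) =
     smult (1 / real (n + 2))
       ([:0, 2 * (real (n + 2) + \<alpha> - 1):] * gegenbauer \<alpha> (Suc n)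
         - smult (real (n + 2) + 2 * \<alpha> - 2) (gegenbauer \<alpha> n))"

end

theory Submission
  imports Defs
begin

text \<open>
  Both sides satisfy the same three-term recurrence in \<open>k\<close>. Put \<open>s = sqrt (1 - x)\<close> and
  \<open>\<alpha> = (\<beta> + 1) / 2 > 0\<close>. The value \<open>C\<^sub>n(1)\<close> obeys the first-order recurrence
  \<open>(n + 1) C\<^sub>n\<^sub>+\<^sub>1(1) = (n + 2 \<alpha>) C\<^sub>n(1)\<close> (lemma \<open>gegenbauer_at_1_Suc\<close>), so it is positive, and dividing
  the Gegenbauer recurrence by it gives for \<open>u\<^sub>n = C\<^sub>n(s) / C\<^sub>n(1)\<close> a recurrence with much simpler
  coefficients (lemma \<open>normalized_gegenbauer_recurrence\<close>),
  \[ (n + 1 + 2\alpha)\, u_{n+2} = 2 (n + 1 + \alpha)\, s\, u_{n+1} - (n + 1)\, u_n . \]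
  With \<open>k = n + 2\<close> the Nesterov parameter is \<open>a\<^sub>k = (n + 1) / (n + 1 + 2 \<alpha>)\<close>, hence
  \<open>1 + a\<^sub>k = 2 (n + 1 + \<alpha>) / (n + 1 + 2 \<alpha>)\<close>: the normalized recurrence reads
  \<open>u\<^sub>n\<^sub>+\<^sub>2 = (1 + a\<^sub>k) s u\<^sub>n\<^sub>+\<^sub>1 - a\<^sub>k u\<^sub>n\<close>. Multiplied by \<open>s ^ (n + 4)\<close> this is exactly the Nesterov recurrence,
  whose factor \<open>1 - x\<close> is \<open>s\<^sup>2\<close>, for \<open>r\<^sub>k = s ^ (k + 1) u\<^sub>k\<^sub>-\<^sub>1\<close>. The initial values are
  \<open>r\<^sub>1 = s\<^sup>2\<close> and, because \<open>a\<^sub>1 = 0\<close>, \<open>r\<^sub>2 = s\<^sup>4\<close>, matching \<open>u\<^sub>0 = 1\<close> and \<open>u\<^sub>1 = s\<close>.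
\<close>

text \<open>
  At the point \<open>1\<close> the two terms of the three-term recurrence combine, since by the induction hypothesis
  \<open>(n + 2 \<alpha>) C\<^sub>n(1)\<close> is again a multiple of \<open>C\<^sub>n\<^sub>+\<^sub>1(1)\<close>.
\<close>

lemma gegenbauer_at_1_Suc:
  "real (Suc n) * poly (gegenbauer \<alpha> (Suc n)) 1 = (real n + 2 * \<alpha>) * poly (gegenbauer \<alpha> n) 1"
proof (induction n)
  case 0
  show ?case by simp
next
  case (Suc n)
  have "real (Suc (Suc n)) * poly (gegenbauer \<alpha> (Suc (Suc n))) 1
      = 2 * (real n + 1 + \<alpha>) * poly (gegenbauer \<alpha> (Suc n)) 1
        - (real n + 2 * \<alpha>) * poly (gegenbauer \<alpha> n) 1"
    by (simp add: field_simps)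
  also have "\<dots> = 2 * (real n + 1 + \<alpha>) * poly (gegenbauer \<alpha> (Suc n)) 1
        - real (Suc n) * poly (gegenbauer \<alpha> (Suc n)) 1"
    by (simp only: Suc.IH)
  also have "\<dots> = (real (Suc n) + 2 * \<alpha>) * poly (gegenbauer \<alpha> (Suc n)) 1"
    by (simp add: algebra_simps)
  finally show ?case .
qed

lemma gegenbauer_at_1_pos:
  assumes "\<alpha> > 0"
  shows "poly (gegenbauer \<alpha> n) 1 > 0"
proof (induction n)
  case 0
  show ?case by simp
next
  case (Suc n)
  have "real (Suc n) * poly (gegenbauer \<alpha> (Suc n)) 1 > 0"
    unfolding gegenbauer_at_1_Suc using assms Suc.IH by (intro mult_pos_pos) auto
  then show ?case
    by (simp only: zero_less_mult_iff) simp
qed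

definition normalized_gegenbauer :: "real \<Rightarrow> nat \<Rightarrow> real \<Rightarrow> real" where
  "normalized_gegenbauer \<alpha> n s = poly (gegenbauer \<alpha> n) s / poly (gegenbauer \<alpha> n) 1"

lemma normalized_gegenbauer_0 [simp]: "normalized_gegenbauer \<alpha> 0 s = 1"
  by (simp add: normalized_gegenbauer_def)

lemma normalized_gegenbauer_1 [simp]:
  "\<alpha> \<noteq> 0 \<Longrightarrow> normalized_gegenbauer \<alpha> (Suc 0) s = s"
  by (simp add: normalized_gegenbauer_def)

text \<open>
  All three normalizing constants are expressible through \<open>C\<^sub>n\<^sub>+\<^sub>1(1)\<close>, which then cancels from the
  Gegenbauer recurrence.
\<close>

lemma normalized_gegenbauer_recurrence:
  assumes "\<alpha> > 0"
  shows "(real n + 1 + 2 * \<alpha>) * normalized_gegenbauer \<alpha> (Suc (Suc n)) s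
    = 2 * (real n + 1 + \<alpha>) * s * normalized_gegenbauer \<alpha> (Suc n) s
      - (real n + 1) * normalized_gegenbauer \<alpha> n s"
proof -
  define c u where "c m = poly (gegenbauer \<alpha> m) 1" and "u m = normalized_gegenbauer \<alpha> m s" for m
  have c_pos: "c m > 0" for m
    unfolding c_def using assms by (rule gegenbauer_at_1_pos)
  have C: "poly (gegenbauer \<alpha> m) s = c m * u m" for m
    using c_pos[of m] by (simp add: u_def c_def normalized_gegenbauer_def)
  have c1: "(real n + 2 * \<alpha>) * c n = (real n + 1) * c (Suc n)"
    using gegenbauer_at_1_Suc[of n \<alpha>] by (simp add: c_def add.commute)
  have c2: "(real n + 2) * c (Suc (Suc n)) = (real n + 1 + 2 * \<alpha>) * c (Suc n)"
    using gegenbauer_at_1_Suc[of "Suc n" \<alpha>]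
    by (simp add: c_def add_ac del: gegenbauer.simps)
  have "(real n + 2) * poly (gegenbauer \<alpha> (Suc (Suc n))) s
      = 2 * (real n + 1 + \<alpha>) * s * poly (gegenbauer \<alpha> (Suc n)) s
        - (real n + 2 * \<alpha>) * poly (gegenbauer \<alpha> n) s"
    by (simp add: field_simps)
  then have "((real n + 2) * c (Suc (Suc n))) * u (Suc (Suc n))
      = 2 * (real n + 1 + \<alpha>) * s * (c (Suc n) * u (Suc n)) - ((real n + 2 * \<alpha>) * c n) * u n"
    by (simp only: C mult.assoc)
  then have "c (Suc n) * ((real n + 1 + 2 * \<alpha>) * u (Suc (Suc n)))
      = c (Suc n) * (2 * (real n + 1 + \<alpha>) * s * u (Suc n) - (real n + 1) * u n)"
    unfolding c1 c2 by (simp add: algebra_simps)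
  then show ?thesis
    using c_pos[of "Suc n"] by (simp add: u_def)
qed

text \<open>
  Parametrizing by \<open>s\<close> with \<open>x = 1 - s\<^sup>2\<close> turns the claim into a polynomial identity in \<open>s\<close>, to
  which induction on \<open>n\<close> and ring arithmetic apply.
\<close>

lemma nesterov_residual_eq_normalized_gegenbauer:
  fixes \<beta> s :: real
  assumes "\<beta> > -1" and a: "\<And>j. j \<ge> 1 \<Longrightarrow> a j = (real j - 1) / (real j + \<beta>)"
  shows "poly (nesterov_residual a (Suc n)) (1 - s\<^sup>2)
    = s ^ (n + 2) * normalized_gegenbauer ((\<beta> + 1) / 2) n s"
proof (induction n rule: induct_nat_012)
  case 0
  show ?case by (simp add: power2_eq_square)
next
  case 1
  have "a (Suc 0) = 0"
    using a[of 1] by simp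
  then show ?case
    using assms(1) by (simp add: power2_eq_square power3_eq_cube algebra_simps)
next
  case (ge2 n)
  define u where "u m = normalized_gegenbauer ((\<beta> + 1) / 2) m s" for m
  define b where "b = a (Suc (Suc n))"
  have pos: "real n + 2 + \<beta> > 0"
    using assms(1) by simp
  have b: "(real n + 2 + \<beta>) * b = real n + 1"
    using a[of "Suc (Suc n)"] pos by (simp add: b_def add_ac)
  have "(real n + 2 + \<beta>) * u (Suc (Suc n))
      = (2 * real n + 3 + \<beta>) * s * u (Suc n) - (real n + 1) * u n"
    using normalized_gegenbauer_recurrence[of "(\<beta> + 1) / 2" n s] assms(1)
    by (simp add: u_def field_simps)
  also have "\<dots> = (real n + 2 + \<beta>) * ((1 + b) * s * u (Suc n) - b * u n)"
    using b by algebra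
  finally have u: "u (Suc (Suc n)) = (1 + b) * s * u (Suc n) - b * u n"
    using pos by simp
  have factor: "poly [:1, -1:] (1 - s\<^sup>2) = s\<^sup>2"
    by simp
  have "poly (nesterov_residual a (Suc (Suc (Suc n)))) (1 - s\<^sup>2)
      = s\<^sup>2 * (s ^ (Suc n + 2) * u (Suc n)
          + b * (s ^ (Suc n + 2) * u (Suc n) - s ^ (n + 2) * u n))"
    by (simp only: nesterov_residual.simps(3)[of a "Suc n"] poly_mult poly_add poly_smult poly_diff
        factor ge2.IH u_def b_def)
  also have "\<dots> = s ^ (Suc (Suc n) + 2) * u (Suc (Suc n))"
    unfolding u by (simp add: algebra_simps power2_eq_square)
  finally show ?case
    by (simp only: u_def)
qed

theorem theorem1:
  fixes \<beta> :: real and a :: "nat \<Rightarrow> real" and k :: nat and x :: real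
  assumes "\<beta> > -1"
    and "\<And>j. j \<ge> 1 \<Longrightarrow> a j = (real j - 1) / (real j + \<beta>)"
    and "k \<ge> 1"
    and "0 \<le> x" and "x \<le> 1"
  shows "poly (nesterov_residual a k) x =
    (1 - x) powr ((real k + 1) / 2) *
      (poly (gegenbauer ((\<beta> + 1) / 2) (k - 1)) (sqrt (1 - x)) /
       poly (gegenbauer ((\<beta> + 1) / 2) (k - 1)) 1)"
proof -
  define s where "s = sqrt (1 - x)"
  obtain n where k: "k = Suc n"
    using assms(3) by (cases k) auto
  have s: "s \<ge> 0" "1 - s\<^sup>2 = x"
    using assms(5) by (auto simp: s_def)
  have power: "(1 - x) powr ((real k + 1) / 2) = s ^ (n + 2)"
  proof (cases "x = 1")
    case True
    \<comment> \<open>Both sides vanish: \<open>0 powr p = 0\<close> holds for every \<open>p\<close>, and the exponent \<open>n + 2\<close> is positive.\<close>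
    then show ?thesis by (simp add: s_def)
  next
    case False
    then have "1 - x > 0"
      using assms(5) by simp
    then have "s ^ (n + 2) = ((1 - x) powr (1 / 2)) powr real (n + 2)"
      by (subst powr_realpow) (auto simp: s_def powr_half_sqrt)
    also have "\<dots> = (1 - x) powr ((real k + 1) / 2)"
      by (simp add: powr_powr k add_ac)
    finally show ?thesis ..
  qed
  have "poly (nesterov_residual a k) x
      = s ^ (n + 2) * normalized_gegenbauer ((\<beta> + 1) / 2) n s"
    using nesterov_residual_eq_normalized_gegenbauer[OF assms(1,2), of n s] by (simp only: k s(2))
  then show ?thesis
    unfolding power normalized_gegenbauer_def by (simp add: k s_def)
qed

end
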